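(* Let $X$ be a real Hilbert space, let $m\in\{2,3,\ldots\}$, and let $C_1,\ldots,C_m$ be nonempty closed convex subsets of $X$ with projectors $P_1,\ldots,P_m$. Let $\mathbf{y}\in X^m$ be the unique solution of $0\in\tfrac12\mathbf{y}+\mathbf{T}\mathbf{y}+\partial\sigma_{\mathbf{C}+\boldsymbol{\Delta}}(\mathbf{y})$, set $\mathbf{e}:=-\tfrac12\mathbf{y}-\mathbf{T}\mathbf{y}$, and let $\mathbf{v}=(v_1,\ldots,v_m):=\mathbf{R}^*\mathbf{e}-\mathbf{e}$, i.e. $v_i=e_{i+1}-e_i$ for $1\le i\le m-1$ and $v_m=e_1-e_m$, where $\mathbf{e}=(e_1,\ldots,e_m)$. Then $$v_1+v_2+\cdots+v_m=0$$ and $$F_m=C_m\cap(C_{m-1}+v_{m-1})\cap(C_{m-2}+v_{m-2}+v_{m-1})\cap\cdots\cap(C_1+v_1+\cdots+v_{m-1}),$$ and analogously for $F_{m-1},\ldots,F_1$; that is, reading all subscripts cyclically modulo $m$ in $\{1,\ldots,m\}$, for every $i\in\{1,\ldots,m\}$, $$F_i=\bigcap_{k=0}^{m-1}\Big(C_{i-k}+\sum_{j=1}^{k}v_{i-j}\Big).$$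
   Context: The fixed point sets of the cyclic compositions are $F_m:=\operatorname{Fix}(P_m\cdots P_1)$, $F_{m-1}:=\operatorname{Fix}(P_{m-1}\cdots P_1P_m)$, ..., $F_1:=\operatorname{Fix}(P_1P_m\cdots P_2)$; they may be empty. $P_i$ is the projector (nearest point map) onto $C_i$. In the product Hilbert space $\mathbf{X}:=X^m$ set $\mathbf{C}:=C_1\times\cdots\times C_m$ and $\boldsymbol{\Delta}:=\{(x,\ldots,x)\in\mathbf{X} : x\in X\}$. The circular right shift is $\mathbf{R}\colon\mathbf{X}\to\mathbf{X}\colon(x_1,\ldots,x_m)\mapsto(x_m,x_1,\ldots,x_{m-1})$, with adjoint $\mathbf{R}^*$ the circular left shift. The skew linear operator $\mathbf{T}$ is $\mathbf{T}:=\frac{1}{2m}\sum_{k=1}^{m-1}(m-2k)\mathbf{R}^k$. $\sigma_{\mathbf{S}}(\mathbf{u})=\sup_{\mathbf{s}\in\mathbf{S}}\langle\mathbf{s},\mathbf{u}\rangle$ denotes the support function of $\mathbf{S}\subseteq\mathbf{X}$ and $\partial$ the convex subdifferential. The operator $\tfrac12\operatorname{Id}+\mathbf{T}+\partial\sigma_{\mathbf{C}+\boldsymbol{\Delta}}$ is maximally and strongly monotone, so it has a unique zero $\mathbf{y}$. *)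

theory Defs
  imports "HOL-Analysis.Analysis"
begin

text \<open>
  Elements of the product Hilbert space \<open>X^m\<close> are extensional functions on the index set
  \<open>{1..m}\<close>, so that two of them are equal iff their \<open>m\<close> components are.
\<close>

definition prod_space :: "nat \<Rightarrow> (nat \<Rightarrow> 'a) set" where
  "prod_space m = {1..m} \<rightarrow>\<^sub>E UNIV"

definition prod_inner :: "nat \<Rightarrow> (nat \<Rightarrow> 'a::real_inner) \<Rightarrow> (nat \<Rightarrow> 'a) \<Rightarrow> real" where
  "prod_inner m x y = (\<Sum>i=1..m. x i \<bullet> y i)"

definition diagonal :: "nat \<Rightarrow> (nat \<Rightarrow> 'a) set" where
  "diagonal m = {(\<lambda>i\<in>{1..m}. x) | x. True}"

definition prod_set_sum :: "nat \<Rightarrow> (nat \<Rightarrow> 'a::plus) set \<Rightarrow> (nat \<Rightarrow> 'a) set \<Rightarrow> (nat \<Rightarrow> 'a) set" where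
  "prod_set_sum m A B = {(\<lambda>i\<in>{1..m}. a i + b i) | a b. a \<in> A \<and> b \<in> B}"

text \<open>The representative in \<open>{1..m}\<close> of an integer modulo \<open>m\<close>; note that \<open>0\<close> is sent to \<open>m\<close>.\<close>

definition cyc :: "nat \<Rightarrow> int \<Rightarrow> nat" where
  "cyc m i = nat ((i - 1) mod int m) + 1"

definition shift_right :: "nat \<Rightarrow> (nat \<Rightarrow> 'a) \<Rightarrow> (nat \<Rightarrow> 'a)" where
  "shift_right m x = (\<lambda>i\<in>{1..m}. x (cyc m (int i - 1)))"

definition shift_left :: "nat \<Rightarrow> (nat \<Rightarrow> 'a) \<Rightarrow> (nat \<Rightarrow> 'a)" where
  "shift_left m x = (\<lambda>i\<in>{1..m}. x (cyc m (int i + 1)))"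

definition skew_op :: "nat \<Rightarrow> (nat \<Rightarrow> 'a::real_vector) \<Rightarrow> (nat \<Rightarrow> 'a)" where
  "skew_op m x = (\<lambda>i\<in>{1..m}. (1 / (2 * real m)) *\<^sub>R
     (\<Sum>k=1..m-1. (real m - 2 * real k) *\<^sub>R (shift_right m ^^ k) x i))"

definition support_fun :: "nat \<Rightarrow> (nat \<Rightarrow> 'a::real_inner) set \<Rightarrow> (nat \<Rightarrow> 'a) \<Rightarrow> ereal" where
  "support_fun m S u = (SUP s\<in>S. ereal (prod_inner m s u))"

text \<open>
  The convex subdifferential of a proper function on \<open>X^m\<close>. It is empty where \<open>f\<close> is
  \<open>\<infinity>\<close>, because a proper \<open>f\<close> is finite at some \<open>z\<close>.
\<close>

definition subdifferential ::
    "nat \<Rightarrow> ((nat \<Rightarrow> 'a::real_inner) \<Rightarrow> ereal) \<Rightarrow> (nat \<Rightarrow> 'a) \<Rightarrow> (nat \<Rightarrow> 'a) set" where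
  "subdifferential m f x = {u \<in> prod_space m. \<forall>z \<in> prod_space m.
     f x + ereal (prod_inner m u (\<lambda>i\<in>{1..m}. z i - x i)) \<le> f z}"

text \<open>
  The library's \<open>closest_point\<close> requires a Heine-Borel space, which excludes
  infinite-dimensional Hilbert spaces.
\<close>

definition projector :: "'a::metric_space set \<Rightarrow> 'a \<Rightarrow> 'a" where
  "projector S x = (THE p. p \<in> S \<and> (\<forall>c\<in>S. dist x p \<le> dist x c))"

text \<open>
  \<open>F_i = Fix (P_i P_{i-1} ... P_1 P_m ... P_{i+1})\<close>: since \<open>fold\<close> applies the head of the
  list first, \<open>P_{i+1}\<close> acts first and \<open>P_{i+m} = P_i\<close> last.
\<close>

definition cyclic_fix :: "nat \<Rightarrow> (nat \<Rightarrow> 'a::metric_space set) \<Rightarrow> nat \<Rightarrow> 'a set" where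
  "cyclic_fix m C i =
     {x. fold (\<lambda>k. projector (C (cyc m (int i + int k)))) [1..<m+1] x = x}"

end

theory Submission
  imports Defs
begin

text \<open>
  The inclusion says that \<open>e\<close> is a subgradient of the support function of \<open>C + \<Delta>\<close> at \<open>y\<close>.
  Hence \<open>y\<close> is orthogonal to \<open>\<Delta>\<close>, where \<open>\<onehalf>Id + T\<close> inverts \<open>Id - R\<close>, and so \<open>y = Re - e\<close>.
  The points of \<open>F_i\<close> are the \<open>i\<close>-th components of the cycles \<open>x\<close>, those \<open>x \<in> C\<close> for which
  \<open>Rx - x\<close> is normal to \<open>C\<close> at \<open>x\<close>. Monotonicity of the subdifferential gives
  \<open>\<langle>w, Rw - w\<rangle> \<ge> 0\<close> for \<open>w = x - e\<close>; as \<open>R\<close> is an isometry, \<open>Rw = w\<close>, so \<open>w\<close> is diagonal.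
  Conversely, if \<open>x \<in> C\<close> and \<open>x - e\<close> is diagonal, then \<open>Rx - x = y\<close> is normal to \<open>C\<close> at \<open>x\<close>,
  because \<open>y\<close> is orthogonal to \<open>\<Delta>\<close>. Thus the cycles are exactly the points of
  \<open>C \<inter> (e + \<Delta>)\<close>.
\<close>

section \<open>Projectors onto closed convex sets\<close>

text \<open>Balls need not be compact, so the nearest point is the limit of a minimizing sequence,
  which is Cauchy by the parallelogram law.\<close>

lemma closest_point_exists_convex:
  fixes S :: "'a::{real_inner, complete_space} set"
  assumes "S \<noteq> {}" "closed S" "convex S"
  shows "\<exists>p\<in>S. \<forall>c\<in>S. dist a p \<le> dist a c"
proof -
  define d where "d = infdist a S"
  have d_le: "d \<le> dist a c" if "c \<in> S" for c
    unfolding d_def using that by (rule infdist_le)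
  have d0: "0 \<le> d" unfolding d_def by (rule infdist_nonneg)
  have "\<exists>c\<in>S. dist a c < d + inverse (real (Suc n))" for n
  proof -
    have "infdist a S < d + inverse (real (Suc n))" unfolding d_def by simp
    then show ?thesis
      using assms(1) by (simp add: infdist_notempty cINF_less_iff)
  qed
  then obtain f where fS: "f n \<in> S" and f: "dist a (f n) < d + inverse (real (Suc n))" for n
    by metis
  have lim: "(\<lambda>n. dist a (f n)) \<longlonglongrightarrow> d"
  proof (rule tendsto_sandwich)
    show "\<forall>\<^sub>F n in sequentially. d \<le> dist a (f n)"
      using d_le[OF fS] by simp
    show "\<forall>\<^sub>F n in sequentially. dist a (f n) \<le> d + inverse (real (Suc n))"
      using less_imp_le[OF f] by (rule always_eventually[OF allI])
    show "(\<lambda>n. d + inverse (real (Suc n))) \<longlonglongrightarrow> d"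
      using tendsto_add[OF tendsto_const LIMSEQ_inverse_real_of_nat, of d] by simp
  qed simp
  \<comment> \<open>Parallelogram identity for \<open>x\<close>, \<open>z\<close> and their midpoint
    \<open>w\<close>, which lies in \<open>S\<close> by convexity and so is at distance at least
    \<open>d\<close> from \<open>a\<close>.\<close>
  have par: "(dist x z)\<^sup>2 \<le> 2 * ((dist a x)\<^sup>2 - d\<^sup>2) + 2 * ((dist a z)\<^sup>2 - d\<^sup>2)"
    if "x \<in> S" "z \<in> S" for x z
  proof -
    define w where "w = (1/2) *\<^sub>R x + (1/2) *\<^sub>R z"
    have "w \<in> S" unfolding w_def using assms(3) that by (intro convexD) auto
    then have "d\<^sup>2 \<le> (dist a w)\<^sup>2" using d_le d0 by (simp add: power_mono)
    moreover have "(dist x z)\<^sup>2 = 2 * (dist a x)\<^sup>2 + 2 * (dist a z)\<^sup>2 - 4 * (dist a w)\<^sup>2"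
      unfolding w_def dist_norm power2_norm_eq_inner
      by (simp add: inner_add_left inner_add_right inner_diff_left inner_diff_right
          inner_commute algebra_simps)
    ultimately show ?thesis by simp
  qed
  have "Cauchy f"
  proof (rule metric_CauchyI)
    fix \<epsilon> :: real assume \<epsilon>: "0 < \<epsilon>"
    have "(\<lambda>n. (dist a (f n))\<^sup>2 - d\<^sup>2) \<longlonglongrightarrow> d\<^sup>2 - d\<^sup>2"
      by (intro tendsto_intros lim)
    \<comment> \<open>In \<open>par\<close> each of the two excesses is weighted by 2, so a quarter
      of the squared tolerance is enough for each.\<close>
    moreover have "d\<^sup>2 - d\<^sup>2 < \<epsilon>\<^sup>2 / 4" using \<epsilon> by simp
    ultimately have "\<forall>\<^sub>F n in sequentially. (dist a (f n))\<^sup>2 - d\<^sup>2 < \<epsilon>\<^sup>2 / 4"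
      by (rule order_tendstoD(2))
    then obtain N where N: "(dist a (f n))\<^sup>2 - d\<^sup>2 < \<epsilon>\<^sup>2 / 4" if "n \<ge> N" for n
      unfolding eventually_sequentially by auto
    have "dist (f k) (f n) < \<epsilon>" if "k \<ge> N" "n \<ge> N" for k n
    proof -
      have "(dist (f k) (f n))\<^sup>2 < \<epsilon>\<^sup>2"
        using par[OF fS fS, of k n] N[OF that(1)] N[OF that(2)] by simp
      then show ?thesis using \<epsilon> power_less_imp_less_base by fastforce
    qed
    then show "\<exists>M. \<forall>k\<ge>M. \<forall>n\<ge>M. dist (f k) (f n) < \<epsilon>" by blast
  qed
  then obtain p where p: "f \<longlonglongrightarrow> p" using Cauchy_convergent convergent_def by blast
  have "p \<in> S" using assms(2) fS p by (rule closed_sequentially)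
  moreover have "dist a p = d"
    using LIMSEQ_unique[OF tendsto_dist[OF tendsto_const p] lim] .
  ultimately show ?thesis using d_le by blast
qed

text \<open>The variational inequality says that \<open>a - p\<close> is normal to \<open>S\<close>
  at \<open>p\<close>. In this form the projection conditions are inequalities that can be summed
  over the components.\<close>

lemma projector_eq_iff:
  fixes S :: "'a::{real_inner, complete_space} set"
  assumes "S \<noteq> {}" "closed S" "convex S"
  shows "p = projector S a \<longleftrightarrow> p \<in> S \<and> (\<forall>c\<in>S. (c - p) \<bullet> (a - p) \<le> 0)"
proof -
  have uniq: "\<exists>!p. p \<in> S \<and> (\<forall>c\<in>S. dist a p \<le> dist a c)"
    using closest_point_exists_convex[OF assms, of a]
      any_closest_point_unique[OF assms(3,2), of _ _ a] by blast
  have near: "projector S a \<in> S \<and> (\<forall>c\<in>S. dist a (projector S a) \<le> dist a c)"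
    unfolding projector_def by (rule theI'[OF uniq])
  show ?thesis
  proof (intro iffI conjI ballI)
    assume p: "p = projector S a"
    then show "p \<in> S" using near by simp
    show "(c - p) \<bullet> (a - p) \<le> 0" if "c \<in> S" for c
      using any_closest_point_dot[OF assms(3,2) _ that, of p a] near p
      by (simp add: inner_commute)
  next
    assume p: "p \<in> S \<and> (\<forall>c\<in>S. (c - p) \<bullet> (a - p) \<le> 0)"
    have "dist a p \<le> dist a c" if "c \<in> S" for c
    proof -
      have "(dist a c)\<^sup>2 = (dist a p)\<^sup>2 + (dist c p)\<^sup>2 - 2 * ((c - p) \<bullet> (a - p))"
        unfolding dist_norm power2_norm_eq_inner
        by (simp add: inner_diff_left inner_diff_right inner_commute algebra_simps)
      moreover have "(c - p) \<bullet> (a - p) \<le> 0" using p that by blast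
      ultimately have "(dist a p)\<^sup>2 \<le> (dist a c)\<^sup>2"
        using zero_le_power2[of "dist c p"] by linarith
      then show ?thesis by (rule power2_le_imp_le) simp
    qed
    then show "p = projector S a" using uniq near p by blast
  qed
qed

section \<open>Cyclic indices\<close>

lemma cyc_mem: "0 < m \<Longrightarrow> cyc m n \<in> {1..m}"
  using pos_mod_bound[of "int m" "n - 1"] pos_mod_sign[of "int m" "n - 1"]
  unfolding cyc_def by (auto simp: nat_less_iff Suc_le_eq)

lemma cyc_of_mem: "i \<in> {1..m} \<Longrightarrow> cyc m (int i) = i"
  by (auto simp: cyc_def)

lemma cyc_eq_iff:
  assumes "0 < m"
  shows "cyc m a = cyc m b \<longleftrightarrow> int m dvd a - b"
proof -
  have "cyc m a = cyc m b \<longleftrightarrow> (a - 1) mod int m = (b - 1) mod int m"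
    using assms by (auto simp: cyc_def eq_nat_nat_iff)
  then show ?thesis by (simp add: mod_eq_dvd_iff)
qed

lemma int_cyc:
  assumes "0 < m"
  shows "int m dvd int (cyc m n) - n"
proof -
  have "int (cyc m n) = (n - 1) mod int m + 1" using assms by (simp add: cyc_def)
  then have "int (cyc m n) - n = (n - 1) mod int m - (n - 1)" by simp
  then show ?thesis by (simp only: mod_eq_dvd_iff[symmetric] mod_mod_trivial)
qed

lemma cyc_cyc_add:
  assumes "0 < m"
  shows "cyc m (int (cyc m n) + d) = cyc m (n + d)"
  using int_cyc[OF assms, of n] by (simp add: cyc_eq_iff[OF assms])

lemma cyc_cyc_diff:
  assumes "0 < m"
  shows "cyc m (int (cyc m n) - d) = cyc m (n - d)"
  using cyc_cyc_add[OF assms, of n "- d"] by simp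

lemma cyc_add_cyc:
  assumes "0 < m"
  shows "cyc m (d + int (cyc m n)) = cyc m (d + n)"
  using cyc_cyc_add[OF assms, of n d] by (simp add: add.commute)

lemma cyc_add_self: "0 < m \<Longrightarrow> cyc m (n + int m) = cyc m n"
  by (simp add: cyc_eq_iff)

lemma cyc_diff_self: "0 < m \<Longrightarrow> cyc m (n - int m) = cyc m n"
  by (simp add: cyc_eq_iff)

text \<open>Any \<open>m\<close> consecutive integers are pairwise incongruent modulo
  \<open>m\<close>; surjectivity then follows by counting.\<close>

lemma bij_betw_cyc_reflect:
  assumes "0 < m"
  shows "bij_betw (\<lambda>k. cyc m (n - int k)) {..<m} {1..m}"
proof -
  have inj: "inj_on (\<lambda>k. cyc m (n - int k)) {..<m}"
  proof (rule inj_onI)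
    fix k l assume kl: "k \<in> {..<m}" "l \<in> {..<m}" "cyc m (n - int k) = cyc m (n - int l)"
    then have "int m dvd int l - int k" by (simp add: cyc_eq_iff[OF assms])
    moreover have "\<bar>int l - int k\<bar> < int m" using kl by auto
    ultimately have "int l - int k = 0"
      using dvd_imp_le_int[of "int l - int k" "int m"] by linarith
    then show "k = l" by simp
  qed
  moreover have "(\<lambda>k. cyc m (n - int k)) ` {..<m} = {1..m}"
    by (rule card_subset_eq) (use cyc_mem[OF assms] inj in \<open>auto simp: card_image\<close>)
  ultimately show ?thesis by (simp add: bij_betw_def)
qed

lemma sum_cyc_reflect:
  assumes "0 < m"
  shows "(\<Sum>k<m. f (cyc m (n - int k))) = (\<Sum>i=1..m. f i)"
  by (rule sum.reindex_bij_betw[OF bij_betw_cyc_reflect[OF assms]])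

lemma sum_cyc_shift:
  assumes "0 < m"
  shows "(\<Sum>i=1..m. f (cyc m (int i + d))) = (\<Sum>i=1..m. f i)"
proof -
  \<comment> \<open>In the reflected enumeration the shift only moves the base point from 0 to
    \<open>d\<close>, and the sum over a full period does not depend on the base point.\<close>
  have "(\<Sum>i=1..m. f (cyc m (int i + d))) = (\<Sum>k<m. f (cyc m (int (cyc m (0 - int k)) + d)))"
    by (rule sum_cyc_reflect[OF assms, symmetric])
  also have "\<dots> = (\<Sum>k<m. f (cyc m (d - int k)))"
    by (simp only: cyc_cyc_add[OF assms]) (simp add: algebra_simps)
  finally show ?thesis by (simp add: sum_cyc_reflect[OF assms])
qed

lemma sum_cyc_pred:
  "0 < m \<Longrightarrow> (\<Sum>i=1..m. f (cyc m (int i - 1))) = (\<Sum>i=1..m. f i)"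
  using sum_cyc_shift[of m f "-1"] by simp

text \<open>Stepping back from \<open>i\<close> reaches every index, so a vector fixed by the right
  shift is diagonal.\<close>

lemma cyc_pred_invariant_const:
  assumes "0 < m" and step: "\<And>n. n \<in> {1..m} \<Longrightarrow> w (cyc m (int n - 1)) = w n"
    and "i \<in> {1..m}" "n \<in> {1..m}"
  shows "w n = w i"
proof -
  have *: "w (cyc m (int i - int k)) = w i" for k
  proof (induction k)
    case (Suc k)
    have "w (cyc m (int i - int (Suc k))) = w (cyc m (int (cyc m (int i - int k)) - 1))"
      by (simp add: cyc_cyc_diff[OF assms(1)] algebra_simps)
    also have "\<dots> = w (cyc m (int i - int k))" by (rule step[OF cyc_mem[OF assms(1)]])
    finally show ?case using Suc by simp
  qed (simp add: cyc_of_mem[OF assms(3)])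
  have "n \<in> (\<lambda>k. cyc m (int i - int k)) ` {..<m}"
    unfolding bij_betw_imp_surj_on[OF bij_betw_cyc_reflect[OF assms(1)]] by (rule assms(4))
  then obtain k where "n = cyc m (int i - int k)" by blast
  then show ?thesis using * by simp
qed

text \<open>The intermediate values of the composition at a fixed point form a cycle, and going once
  around a cycle evaluates the composition. This moves the problem into the product space.\<close>

lemma cyclic_fix_iff_cycle:
  assumes "0 < m" "i \<in> {1..m}"
  shows "x \<in> cyclic_fix m C i \<longleftrightarrow>
    (\<exists>X. X i = x \<and> (\<forall>n\<in>{1..m}. X n = projector (C n) (X (cyc m (int n - 1)))))"
proof
  let ?f = "\<lambda>k. projector (C (cyc m (int i + int k)))"
  assume "x \<in> cyclic_fix m C i"
  then have fixed: "fold ?f [1..<m+1] x = x" by (simp add: cyclic_fix_def)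
  define a where "a k = fold ?f [1..<k+1] x" for k
  have a0: "a 0 = x" by (simp add: a_def)
  have am: "a m = x" using fixed by (simp add: a_def)
  have a_Suc: "a (Suc k) = ?f (Suc k) (a k)" for k by (simp add: a_def)
  \<comment> \<open>Since \<open>cyc\<close> takes values in \<open>{1..m}\<close>, index
    \<open>i\<close> receives \<open>a m\<close> and not \<open>a 0\<close>; both equal
    \<open>x\<close>.\<close>
  define X where "X n = a (cyc m (int n - int i))" for n
  have "X i = x" using assms(1) am cyc_add_self[of m 0] cyc_of_mem[of m m]
    by (simp add: X_def)
  moreover have "X n = projector (C n) (X (cyc m (int n - 1)))" if n: "n \<in> {1..m}" for n
  proof -
    define k where "k = cyc m (int n - int i)"
    have k: "k \<in> {1..m}" unfolding k_def by (rule cyc_mem[OF assms(1)])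
    then obtain l where l: "k = Suc l" by (cases k) auto
    have "cyc m (int i + int k) = n"
      unfolding k_def using n by (simp add: cyc_add_cyc[OF assms(1)] cyc_of_mem)
    then have "X n = projector (C n) (a l)"
      unfolding X_def k_def[symmetric] by (simp add: l a_Suc)
    moreover have "X (cyc m (int n - 1)) = a l"
    proof -
      have "cyc m (int (cyc m (int n - 1)) - int i) = cyc m (int l)"
      proof -
        have "cyc m (int (cyc m (int n - 1)) - int i) = cyc m ((int n - int i) - 1)"
          by (simp add: cyc_cyc_diff[OF assms(1)] algebra_simps)
        also have "\<dots> = cyc m (int k - 1)"
          unfolding k_def by (simp add: cyc_cyc_diff[OF assms(1)])
        finally show ?thesis by (simp add: l)
      qed
      then have "X (cyc m (int n - 1)) = a (cyc m (int l))" by (simp add: X_def)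
      moreover have "a (cyc m (int l)) = a l"
      \<comment> \<open>For \<open>l = 0\<close> the representative is \<open>m\<close>, and
        \<open>a m = a 0\<close> closes the cycle.\<close>
      proof (cases "l = 0")
        case True
        then show ?thesis using a0 am assms(1) cyc_add_self[of m 0] cyc_of_mem[of m m] by simp
      next
        case False
        then show ?thesis using k l by (subst cyc_of_mem) auto
      qed
      ultimately show ?thesis by simp
    qed
    ultimately show ?thesis by simp
  qed
  ultimately show "\<exists>X. X i = x \<and> (\<forall>n\<in>{1..m}. X n = projector (C n) (X (cyc m (int n - 1))))"
    by blast
next
  let ?f = "\<lambda>k. projector (C (cyc m (int i + int k)))"
  assume "\<exists>X. X i = x \<and> (\<forall>n\<in>{1..m}. X n = projector (C n) (X (cyc m (int n - 1))))"
  then obtain X where X: "X i = x"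
    "\<And>n. n \<in> {1..m} \<Longrightarrow> X n = projector (C n) (X (cyc m (int n - 1)))" by blast
  \<comment> \<open>Invariant: after \<open>k\<close> projections the orbit has reached component
    \<open>i + k\<close>; for \<open>k = m\<close> it is back at \<open>i\<close>.\<close>
  have "fold ?f [1..<k+1] x = X (cyc m (int i + int k))" for k
  proof (induction k)
    case 0
    then show ?case using X(1) assms(2) by (simp add: cyc_of_mem)
  next
    case (Suc k)
    have "X (cyc m (int i + int (Suc k))) =
      projector (C (cyc m (int i + int (Suc k)))) (X (cyc m (int (cyc m (int i + int (Suc k))) - 1)))"
      by (rule X(2)[OF cyc_mem[OF assms(1)]])
    also have "cyc m (int (cyc m (int i + int (Suc k))) - 1) = cyc m (int i + int k)"
      by (simp add: cyc_cyc_diff[OF assms(1)])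
    finally show ?case using Suc by simp
  qed
  from this[of m] have "fold ?f [1..<m+1] x = x"
    using X(1) assms by (simp add: cyc_add_self cyc_of_mem)
  then show "x \<in> cyclic_fix m C i" by (simp add: cyclic_fix_def)
qed

section \<open>The skew operator\<close>

lemma funpow_shift_right:
  assumes "0 < m" "i \<in> {1..m}"
  shows "(shift_right m ^^ k) x i = x (cyc m (int i - int k))"
  using assms(2)
proof (induction k arbitrary: i)
  case (Suc k)
  have "(shift_right m ^^ Suc k) x i = (shift_right m ^^ k) x (cyc m (int i - 1))"
    using Suc.prems by (simp add: shift_right_def)
  also have "\<dots> = x (cyc m (int (cyc m (int i - 1)) - int k))"
    by (rule Suc.IH[OF cyc_mem[OF assms(1)]])
  finally show ?case by (simp add: cyc_cyc_diff[OF assms(1)] algebra_simps)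
qed (simp add: cyc_of_mem)

text \<open>The term \<open>(1/2) *\<^sub>R y i\<close> is exactly the missing summand
  \<open>k = 0\<close>, of weight \<open>m / (2 m)\<close>, so the sum runs over a full
  period.\<close>

lemma half_plus_skew_op:
  assumes "0 < m" "i \<in> {1..m}"
  shows "(1/2) *\<^sub>R y i + skew_op m y i =
    (1 / (2 * real m)) *\<^sub>R (\<Sum>k<m. (real m - 2 * real k) *\<^sub>R y (cyc m (int i - int k)))"
proof -
  have "{..<m} = insert 0 {1..m-1}" using assms(1) by auto
  then have "(\<Sum>k<m. (real m - 2 * real k) *\<^sub>R y (cyc m (int i - int k))) =
    real m *\<^sub>R y i + (\<Sum>k=1..m-1. (real m - 2 * real k) *\<^sub>R y (cyc m (int i - int k)))"
    using assms by (simp add: cyc_of_mem)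
  then show ?thesis
    using assms by (simp add: skew_op_def funpow_shift_right scaleR_add_right)
qed

text \<open>Summation by parts: consecutive weights differ by 2, which leaves a multiple of the
  plain sum and two boundary terms.\<close>

lemma sum_affine_telescope:
  fixes g :: "nat \<Rightarrow> 'a::real_vector"
  shows "(\<Sum>k<n. (r - 2 * real k) *\<^sub>R g k) - (\<Sum>k<n. (r - 2 * real k) *\<^sub>R g (Suc k)) =
    (r + 2) *\<^sub>R g 0 - 2 *\<^sub>R (\<Sum>k<n. g k) - (r - 2 * real n + 2) *\<^sub>R g n"
  by (induction n) (simp_all add: algebra_simps)

text \<open>On the orthogonal complement of the diagonal, Id - R undoes half the identity plus T:
  the plain sum over a period vanishes, and the boundary weights \<open>m + 2\<close> and
  \<open>m - 2\<close> add up to \<open>2 m\<close>.\<close>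

lemma half_plus_skew_op_diff:
  assumes "0 < m" "i \<in> {1..m}" "(\<Sum>j=1..m. y j) = 0"
  shows "((1/2) *\<^sub>R y i + skew_op m y i) -
    ((1/2) *\<^sub>R y (cyc m (int i - 1)) + skew_op m y (cyc m (int i - 1))) = y i"
proof -
  define g where "g k = y (cyc m (int i - int k))" for k
  have g: "g 0 = y i" "g m = y i"
    using assms by (simp_all add: g_def cyc_of_mem cyc_diff_self)
  have "(\<Sum>k<m. g k) = 0" unfolding g_def using assms by (simp add: sum_cyc_reflect)
  then have "(\<Sum>k<m. (real m - 2 * real k) *\<^sub>R g k)
      - (\<Sum>k<m. (real m - 2 * real k) *\<^sub>R g (Suc k)) = (2 * real m) *\<^sub>R y i"
    unfolding sum_affine_telescope g by (simp add: algebra_simps flip: scaleR_add_left)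
  moreover have "y (cyc m (int (cyc m (int i - 1)) - int k)) = g (Suc k)" for k
    by (simp add: g_def cyc_cyc_diff[OF assms(1)] algebra_simps)
  ultimately show ?thesis
    using assms(1)
    by (simp add: half_plus_skew_op[OF assms(1,2)] half_plus_skew_op[OF assms(1) cyc_mem[OF assms(1)]]
        g_def[symmetric] flip: scaleR_diff_right)
qed

section \<open>Subgradients of support functions\<close>

lemma prod_inner_scale_right:
  "prod_inner m u (\<lambda>i\<in>{1..m}. t *\<^sub>R z i) = t * prod_inner m u z"
  by (simp add: prod_inner_def sum_distrib_left)

lemma prod_inner_diff_right:
  "prod_inner m u (\<lambda>i\<in>{1..m}. z i - y i) = prod_inner m u z - prod_inner m u y"
  by (simp add: prod_inner_def inner_diff_right sum_subtractf)

text \<open>By positive homogeneity, the subgradient inequality at 0 and at twice \<open>y\<close>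
  gives the two halves of the equality; its terms at \<open>y\<close> then cancel for every other
  \<open>z\<close>.\<close>

lemma subdifferential_support_fun:
  assumes "S \<noteq> {}" "y \<in> prod_space m" "e \<in> subdifferential m (support_fun m S) y"
  shows "support_fun m S y = ereal (prod_inner m e y)"
    and "z \<in> prod_space m \<Longrightarrow> ereal (prod_inner m e z) \<le> support_fun m S z"
proof -
  have sub: "support_fun m S y + ereal (prod_inner m e z - prod_inner m e y) \<le> support_fun m S z"
    if "z \<in> prod_space m" for z
    using assms(3) that
    unfolding subdifferential_def prod_inner_diff_right[symmetric] by blast
  have upper: "ereal (prod_inner m s z) \<le> support_fun m S z" if "s \<in> S" for s z
    unfolding support_fun_def using that by (rule SUP_upper)
  obtain s where s: "s \<in> S" using assms(1) by blast
  define zero two :: "nat \<Rightarrow> 'a"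
    where "zero = (\<lambda>i\<in>{1..m}. 0 *\<^sub>R y i)" and "two = (\<lambda>i\<in>{1..m}. 2 *\<^sub>R y i)"
  have sp: "zero \<in> prod_space m" "two \<in> prod_space m"
    by (simp_all add: zero_def two_def prod_space_def)
  have "support_fun m S zero = 0"
    unfolding support_fun_def zero_def prod_inner_scale_right
    using assms(1) by (simp flip: zero_ereal_def)
  then have le: "support_fun m S y + ereal (- prod_inner m e y) \<le> 0"
    using sub[OF sp(1)] unfolding zero_def prod_inner_scale_right by simp
  \<comment> \<open>Finiteness at \<open>y\<close>: the inequality \<open>le\<close> excludes
    \<infinity>, and a point of \<open>S\<close> excludes -\<infinity>.\<close>
  moreover have "support_fun m S y \<noteq> - \<infinity>" using upper[OF s, of y] by auto
  ultimately obtain r where r: "support_fun m S y = ereal r"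
    by (cases "support_fun m S y") auto
  have "support_fun m S two \<le> ereal (2 * r)"
    unfolding support_fun_def two_def prod_inner_scale_right
    using upper[where z = y] r by (intro SUP_least) auto
  then have "r + prod_inner m e y \<le> 2 * r"
    using order_trans[OF sub[OF sp(2)]] r unfolding two_def prod_inner_scale_right by fastforce
  with le r have "r = prod_inner m e y" by simp
  with r show eq: "support_fun m S y = ereal (prod_inner m e y)" by simp
  show "ereal (prod_inner m e z) \<le> support_fun m S z" if "z \<in> prod_space m"
    using sub[OF that] eq by simp
qed

lemma prod_inner_add_const:
  "prod_inner m (\<lambda>i\<in>{1..m}. c i + (\<lambda>i\<in>{1..m}. d) i) z = prod_inner m c z + d \<bullet> (\<Sum>i=1..m. z i)"
  by (simp add: prod_inner_def inner_add_left sum.distrib inner_sum_right)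

text \<open>Diagonal translations are unbounded, so finiteness of the support function at
  \<open>y\<close> makes \<open>y\<close> orthogonal to them. The last claim serves in place of
  membership of \<open>e\<close> in the sum of \<open>A\<close> and the diagonal, a set that need
  not be closed.\<close>

lemma subgradient_support_sum_diagonal:
  fixes y e :: "nat \<Rightarrow> 'a::real_inner"
  assumes "A \<noteq> {}" "y \<in> prod_space m"
    and "e \<in> subdifferential m (support_fun m (prod_set_sum m A (diagonal m))) y"
  shows "(\<Sum>i=1..m. y i) = 0"
    and "c \<in> A \<Longrightarrow> prod_inner m c y \<le> prod_inner m e y"
    and "z \<in> prod_space m \<Longrightarrow> (\<Sum>i=1..m. z i) = 0 \<Longrightarrow>
      (\<And>c. c \<in> A \<Longrightarrow> prod_inner m c z \<le> B) \<Longrightarrow> prod_inner m e z \<le> B"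
proof -
  define S where "S = prod_set_sum m A (diagonal m)"
  have S: "S = {(\<lambda>i\<in>{1..m}. c i + (\<lambda>i\<in>{1..m}. d) i) | c d. c \<in> A}"
    unfolding S_def prod_set_sum_def diagonal_def by blast
  have "S \<noteq> {}" using assms(1) unfolding S by blast
  note supp = subdifferential_support_fun[OF this assms(2) assms(3)[folded S_def]]
  have bound: "prod_inner m c y + d \<bullet> (\<Sum>i=1..m. y i) \<le> prod_inner m e y" if "c \<in> A" for c d
  proof -
    have "ereal (prod_inner m (\<lambda>i\<in>{1..m}. c i + (\<lambda>i\<in>{1..m}. d) i) y) \<le> support_fun m S y"
      unfolding support_fun_def by (rule SUP_upper) (use that in \<open>unfold S, blast\<close>)
    then show ?thesis unfolding prod_inner_add_const supp(1) by simp
  qed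
  obtain c where c: "c \<in> A" using assms(1) by blast
  show sum0: "(\<Sum>i=1..m. y i) = 0"
  proof (rule ccontr)
    let ?s = "\<Sum>i=1..m. y i"
    assume nz: "?s \<noteq> 0"
    \<comment> \<open>\<open>b\<close> is the slack that \<open>bound\<close> leaves for
      \<open>d\<close>; the multiple of \<open>?s\<close> taken below pairs with \<open>?s\<close>
      to \<open>b + 1\<close>.\<close>
    define b where "b = prod_inner m e y - prod_inner m c y"
    have "((b + 1) / (?s \<bullet> ?s)) *\<^sub>R ?s \<bullet> ?s \<le> b"
      using bound[OF c, of "((b + 1) / (?s \<bullet> ?s)) *\<^sub>R ?s"] unfolding b_def by linarith
    then show False using nz by simp
  qed
  show "prod_inner m c y \<le> prod_inner m e y" if "c \<in> A" for c
    using bound[OF that, of 0] by simp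
  show "prod_inner m e z \<le> B" if "z \<in> prod_space m" "(\<Sum>i=1..m. z i) = 0"
    "\<And>c. c \<in> A \<Longrightarrow> prod_inner m c z \<le> B"
  proof -
    have "support_fun m S z \<le> ereal B"
      unfolding support_fun_def
    proof (rule SUP_least)
      fix s assume "s \<in> S"
      then obtain c d where "c \<in> A" "s = (\<lambda>i\<in>{1..m}. c i + (\<lambda>i\<in>{1..m}. d) i)"
        unfolding S by blast
      then show "ereal (prod_inner m s z) \<le> ereal B"
        using that(2,3) by (simp only: prod_inner_add_const) simp
    qed
    then have "ereal (prod_inner m e z) \<le> ereal B" using supp(2)[OF that(1)] order_trans by blast
    then show ?thesis by simp
  qed
qed

section \<open>Cycles and the displacement vector\<close>

text \<open>As R is an isometry, the squared norm of Rw - w equals -2 times the inner product of w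
  with Rw - w, hence is at most 0.\<close>

lemma inner_shift_ge_imp_invariant:
  fixes w :: "nat \<Rightarrow> 'a::real_inner"
  assumes "0 < m" and "0 \<le> (\<Sum>i=1..m. w i \<bullet> (w (cyc m (int i - 1)) - w i))"
    and "n \<in> {1..m}"
  shows "w (cyc m (int n - 1)) = w n"
proof -
  let ?p = "\<lambda>i. w (cyc m (int i - 1))"
  have "(\<Sum>i=1..m. (?p i - w i) \<bullet> (?p i - w i)) =
      (\<Sum>i=1..m. ?p i \<bullet> ?p i) - (\<Sum>i=1..m. w i \<bullet> w i) - 2 * (\<Sum>i=1..m. w i \<bullet> (?p i - w i))"
    unfolding sum_distrib_left sum_subtractf[symmetric]
    by (rule sum.cong)
      (simp_all add: inner_diff_left inner_diff_right inner_commute algebra_simps)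
  also have "\<dots> \<le> 0"
    using assms(2) sum_cyc_pred[OF assms(1), of "\<lambda>i. w i \<bullet> w i"] by simp
  finally have le0: "(\<Sum>i=1..m. (?p i - w i) \<bullet> (?p i - w i)) \<le> 0" .
  have "(\<Sum>i=1..m. (?p i - w i) \<bullet> (?p i - w i)) = 0"
    by (rule antisym[OF le0]) (simp add: sum_nonneg)
  then have "(?p n - w n) \<bullet> (?p n - w n) = 0"
    using assms(3) by (subst (asm) sum_nonneg_eq_0_iff) auto
  then show ?thesis by simp
qed

text \<open>Here \<open>e\<close> acts as a generalized cycle: \<open>normal\<close> and
  \<open>supp\<close> replace the conditions that \<open>e\<close> lies in the product of the sets
  and that \<open>y\<close> is normal there.\<close>

lemma cycle_iff_displacement:
  fixes C :: "nat \<Rightarrow> 'a::{real_inner, complete_space} set" and e X :: "nat \<Rightarrow> 'a"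
  assumes m: "0 < m" and C: "\<And>n. n \<in> {1..m} \<Longrightarrow> C n \<noteq> {} \<and> closed (C n) \<and> convex (C n)"
    and y: "\<And>n. n \<in> {1..m} \<Longrightarrow> y n = e (cyc m (int n - 1)) - e n"
    and normal: "\<And>c. c \<in> Pi\<^sub>E {1..m} C \<Longrightarrow> prod_inner m c y \<le> prod_inner m e y"
    and supp: "\<And>z B. z \<in> prod_space m \<Longrightarrow> (\<Sum>i=1..m. z i) = 0 \<Longrightarrow>
      (\<And>c. c \<in> Pi\<^sub>E {1..m} C \<Longrightarrow> prod_inner m c z \<le> B) \<Longrightarrow> prod_inner m e z \<le> B"
  shows "(\<forall>n\<in>{1..m}. X n = projector (C n) (X (cyc m (int n - 1)))) \<longleftrightarrow>
    (\<forall>n\<in>{1..m}. X n \<in> C n \<and> X (cyc m (int n - 1)) - e (cyc m (int n - 1)) = X n - e n)"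
    (is "?L \<longleftrightarrow> ?R")
proof
  assume L: ?L
  have X: "X n \<in> C n" "\<And>c. c \<in> C n \<Longrightarrow> (c - X n) \<bullet> (X (cyc m (int n - 1)) - X n) \<le> 0"
    if "n \<in> {1..m}" for n
    using L C that projector_eq_iff[of "C n" "X n" "X (cyc m (int n - 1))"] by auto
  \<comment> \<open>This is RX - X. It sums to zero because R permutes the components, so
    \<open>supp\<close> applies with the bound \<open>prod_inner m X z\<close>.\<close>
  define z where "z = (\<lambda>n\<in>{1..m}. X (cyc m (int n - 1)) - X n)"
  have z_sum: "(\<Sum>i=1..m. z i) = 0"
    by (simp add: z_def sum_subtractf sum_cyc_pred[OF m] del: One_nat_def)
  have "prod_inner m c z \<le> prod_inner m X z" if c: "c \<in> Pi\<^sub>E {1..m} C" for c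
    unfolding prod_inner_def
  proof (rule sum_mono)
    fix i assume i: "i \<in> {1..m}"
    then have "(c i - X i) \<bullet> z i \<le> 0" using X(2)[OF i PiE_mem[OF c i]] by (simp add: z_def)
    then show "c i \<bullet> z i \<le> X i \<bullet> z i" by (simp add: inner_diff_left)
  qed
  then have ez: "prod_inner m e z \<le> prod_inner m X z"
    using z_sum by (intro supp) (auto simp: z_def prod_space_def)
  have Xy: "prod_inner m X y \<le> prod_inner m e y"
  proof -
    have "restrict X {1..m} \<in> Pi\<^sub>E {1..m} C" using X(1) by auto
    from normal[OF this] show ?thesis by (simp add: prod_inner_def)
  qed
  define w where "w n = X n - e n" for n
  \<comment> \<open>Since Rw - w = z - y, the sum splits into a difference that is nonnegative by
    \<open>ez\<close> minus one that is nonpositive by \<open>Xy\<close>.\<close>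
  have "(\<Sum>i=1..m. w i \<bullet> (w (cyc m (int i - 1)) - w i)) =
      (prod_inner m X z - prod_inner m e z) - (prod_inner m X y - prod_inner m e y)"
    unfolding prod_inner_def sum_subtractf[symmetric]
    by (rule sum.cong)
      (simp_all add: w_def z_def y inner_diff_left inner_diff_right algebra_simps)
  then have "0 \<le> (\<Sum>i=1..m. w i \<bullet> (w (cyc m (int i - 1)) - w i))" using ez Xy by simp
  then have "w (cyc m (int n - 1)) = w n" if "n \<in> {1..m}" for n
    using inner_shift_ge_imp_invariant[OF m] that by blast
  then show ?R using X(1) by (simp add: w_def)
next
  assume R: ?R
  have "(c - X n) \<bullet> (X (cyc m (int n - 1)) - X n) \<le> 0" if n: "n \<in> {1..m}" and c: "c \<in> C n" for n c
  proof -
    have Xd: "X i = e i + (X n - e n)" if "i \<in> {1..m}" for i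
      using cyc_pred_invariant_const[OF m, of "\<lambda>i. X i - e i", OF _ n that] R
      by (auto simp: algebra_simps)
    have y_sum: "(\<Sum>i=1..m. y i) = 0"
      by (simp add: y sum_subtractf sum_cyc_pred[OF m] del: One_nat_def)
    \<comment> \<open>Changing only component \<open>n\<close> isolates the inequality for
      \<open>C n\<close> from the one for the product.\<close>
    have "restrict (X(n := c)) {1..m} \<in> Pi\<^sub>E {1..m} C" using R n c by auto
    from normal[OF this] have "(\<Sum>i=1..m. (X(n := c)) i \<bullet> y i) \<le> (\<Sum>i=1..m. e i \<bullet> y i)"
      by (simp add: prod_inner_def)
    \<comment> \<open>\<open>X\<close> and \<open>e\<close> differ by a diagonal vector, to which
      \<open>y\<close> is orthogonal, so \<open>X\<close> may replace \<open>e\<close>.\<close>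
    also have "(\<Sum>i=1..m. e i \<bullet> y i) = (\<Sum>i=1..m. X i \<bullet> y i) - (X n - e n) \<bullet> (\<Sum>i=1..m. y i)"
      unfolding inner_sum_right sum_subtractf[symmetric]
      by (rule sum.cong) (simp_all add: Xd inner_add_left)
    finally have "(\<Sum>i=1..m. (X(n := c)) i \<bullet> y i) \<le> (\<Sum>i=1..m. X i \<bullet> y i)"
      unfolding y_sum by simp
    then have "c \<bullet> y n \<le> X n \<bullet> y n"
      using n by (simp add: sum.remove[of "{1..m}" n] del: One_nat_def)
    moreover have "X (cyc m (int n - 1)) - X n = y n"
      using R n by (auto simp: y algebra_simps)
    ultimately show ?thesis by (simp add: inner_diff_left)
  qed
  then show ?L using R C by (simp add: projector_eq_iff)
qed

section \<open>From displacements to the intersection formula\<close>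

text \<open>The sum telescopes, so each set in the intersection is some \<open>C n\<close>
  translated by \<open>e i - e n\<close>.\<close>

lemma sum_displacement_reflect:
  fixes e v :: "nat \<Rightarrow> 'a::real_vector"
  assumes "0 < m" "i \<in> {1..m}"
    and "\<And>n. n \<in> {1..m} \<Longrightarrow> v n = e (cyc m (int n + 1)) - e n"
  shows "(\<Sum>j=1..k. v (cyc m (int i - int j))) = e i - e (cyc m (int i - int k))"
proof (induction k)
  case (Suc k)
  then show ?case
    using assms(3)[OF cyc_mem[OF assms(1)], of "int i - int (Suc k)"]
    by (simp add: cyc_cyc_add[OF assms(1)])
qed (use assms(2) in \<open>simp add: cyc_of_mem\<close>)

theorem theorem3p4:
  fixes m :: nat
    and C :: "nat \<Rightarrow> 'a::{real_inner, complete_space} set"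
    and y e v :: "nat \<Rightarrow> 'a"
  assumes "m \<ge> 2"
    and "\<And>i. i \<in> {1..m} \<Longrightarrow> C i \<noteq> {} \<and> closed (C i) \<and> convex (C i)"
    and "y \<in> prod_space m"
    and "(\<lambda>i\<in>{1..m}. 0) \<in>
           (\<lambda>s. \<lambda>i\<in>{1..m}. (1/2) *\<^sub>R y i + skew_op m y i + s i) `
             subdifferential m
               (support_fun m (prod_set_sum m (Pi\<^sub>E {1..m} C) (diagonal m))) y"
    and "e = (\<lambda>i\<in>{1..m}. - ((1/2) *\<^sub>R y i) - skew_op m y i)"
    and "v = (\<lambda>i\<in>{1..m}. shift_left m e i - e i)"
  shows "(\<Sum>i=1..m. v i) = 0 \<and>
    cyclic_fix m C m = (\<Inter>k\<in>{0..m-1}. (\<lambda>c. c + (\<Sum>j=1..k. v (m - j))) ` C (m - k)) \<and>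
    (\<forall>i\<in>{1..m}. cyclic_fix m C i =
       (\<Inter>k\<in>{0..m-1}. (\<lambda>c. c + (\<Sum>j=1..k. v (cyc m (int i - int j))))
          ` C (cyc m (int i - int k))))"
proof -
  have m: "0 < m" using assms(1) by simp
  have e_sub: "e \<in> subdifferential m (support_fun m (prod_set_sum m (Pi\<^sub>E {1..m} C) (diagonal m))) y"
  proof -
    obtain s where s: "s \<in> subdifferential m
        (support_fun m (prod_set_sum m (Pi\<^sub>E {1..m} C) (diagonal m))) y"
      and eq: "(\<lambda>i\<in>{1..m}. 0) = (\<lambda>i\<in>{1..m}. (1/2) *\<^sub>R y i + skew_op m y i + s i)"
      using assms(4) by blast
    have "s \<in> extensional {1..m}"
      using s by (auto simp: subdifferential_def prod_space_def PiE_def)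
    moreover have "e i = s i" if "i \<in> {1..m}" for i
    proof -
      have "0 = (1/2) *\<^sub>R y i + skew_op m y i + s i" using fun_cong[OF eq, of i] that by simp
      then have "s i = - ((1/2) *\<^sub>R y i + skew_op m y i)"
        by (metis add.commute eq_neg_iff_add_eq_0)
      then show ?thesis using that unfolding assms(5) by simp
    qed
    ultimately have "e = s" unfolding assms(5) by (intro extensionalityI[of _ "{1..m}"]) auto
    then show ?thesis using s by simp
  qed
  have ne: "Pi\<^sub>E {1..m} C \<noteq> {}" using assms(2) by (simp add: PiE_eq_empty_iff)
  note subgrad = subgradient_support_sum_diagonal[OF ne assms(3) e_sub]
  \<comment> \<open>As \<open>e\<close> is the negative of half the identity plus T applied to
    \<open>y\<close>, inverting by Id - R gives y = Re - e.\<close>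
  have y: "y n = e (cyc m (int n - 1)) - e n" if "n \<in> {1..m}" for n
    using half_plus_skew_op_diff[OF m that subgrad(1)] that cyc_mem[OF m, of "int n - 1"]
    unfolding assms(5) by (simp add: algebra_simps)
  have v: "v n = e (cyc m (int n + 1)) - e n" if "n \<in> {1..m}" for n
    using that by (simp add: assms(6) shift_left_def)
  have v_sum: "(\<Sum>i=1..m. v i) = 0"
    by (simp add: v sum_subtractf sum_cyc_shift[OF m] del: One_nat_def)
  have cycle: "(\<forall>n\<in>{1..m}. X n = projector (C n) (X (cyc m (int n - 1)))) \<longleftrightarrow>
    (\<forall>n\<in>{1..m}. X n \<in> C n \<and> X (cyc m (int n - 1)) - e (cyc m (int n - 1)) = X n - e n)" for X
    using m assms(2) y subgrad(2,3) by (rule cycle_iff_displacement)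
  have F: "cyclic_fix m C i =
       (\<Inter>k\<in>{0..m-1}. (\<lambda>c. c + (\<Sum>j=1..k. v (cyc m (int i - int j))))
          ` C (cyc m (int i - int k)))" if i: "i \<in> {1..m}" for i
  proof (rule set_eqI)
    fix x
    have idx: "{0..m-1} = {..<m}" using m by auto
    have surj: "(\<lambda>k. cyc m (int i - int k)) ` {..<m} = {1..m}"
      using bij_betw_cyc_reflect[OF m] by (rule bij_betw_imp_surj_on)
    \<comment> \<open>Membership in a translate depends on \<open>k\<close> only through the index
      \<open>n = cyc m (i - k)\<close>, which runs over all of \<open>{1..m}\<close>.\<close>
    have "x \<in> (\<lambda>c. c + (\<Sum>j=1..k. v (cyc m (int i - int j)))) ` C (cyc m (int i - int k))
      \<longleftrightarrow> x - e i + e (cyc m (int i - int k)) \<in> C (cyc m (int i - int k))" for k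
    proof -
      have eq: "(\<Sum>j=1..k. v (cyc m (int i - int j))) = e i - e (cyc m (int i - int k))"
        using m i v by (rule sum_displacement_reflect)
      have translate: "x \<in> (\<lambda>c. c + d) ` A \<longleftrightarrow> x - d \<in> A" for d and A :: "'a set"
        by force
      show ?thesis unfolding eq translate by (simp add: algebra_simps)
    qed
    then have "x \<in> (\<Inter>k\<in>{0..m-1}. (\<lambda>c. c + (\<Sum>j=1..k. v (cyc m (int i - int j))))
          ` C (cyc m (int i - int k))) \<longleftrightarrow>
        (\<forall>n\<in>(\<lambda>k. cyc m (int i - int k)) ` {..<m}. x - e i + e n \<in> C n)"
      unfolding idx by simp
    also have "\<dots> \<longleftrightarrow> (\<forall>n\<in>{1..m}. x - e i + e n \<in> C n)" unfolding surj ..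
    also have "\<dots> \<longleftrightarrow> (\<exists>X. X i = x \<and> (\<forall>n\<in>{1..m}. X n \<in> C n \<and>
        X (cyc m (int n - 1)) - e (cyc m (int n - 1)) = X n - e n))"
      (is "?A \<longleftrightarrow> (\<exists>X. ?B X)")
    proof
      assume ?A
      \<comment> \<open>The witness is the only translate of \<open>e\<close> by a diagonal vector
        whose component \<open>i\<close> is \<open>x\<close>.\<close>
      then have "?B (\<lambda>n. x - e i + e n)" by simp
      then show "\<exists>X. ?B X" by (rule exI[where P = ?B])
    next
      assume "\<exists>X. ?B X"
      then obtain X where X: "?B X" ..
      have "X n = x - e i + e n" if "n \<in> {1..m}" for n
        using cyc_pred_invariant_const[OF m, of "\<lambda>i. X i - e i", OF _ i that] X
        by (auto simp: algebra_simps)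
      moreover have "X n \<in> C n" if "n \<in> {1..m}" for n using X that by blast
      ultimately show ?A by simp
    qed
    also have "\<dots> \<longleftrightarrow> x \<in> cyclic_fix m C i"
      unfolding cyclic_fix_iff_cycle[OF m i] cycle ..
    finally show "x \<in> cyclic_fix m C i \<longleftrightarrow>
      x \<in> (\<Inter>k\<in>{0..m-1}. (\<lambda>c. c + (\<Sum>j=1..k. v (cyc m (int i - int j))))
          ` C (cyc m (int i - int k)))" by simp
  qed
  \<comment> \<open>For base index \<open>m\<close> nothing wraps around, since \<open>m - j\<close>
    is at least 1.\<close>
  have cyc_m: "cyc m (int m - int j) = m - j" if "j \<le> m - 1" for j
    using cyc_of_mem[of "m - j" m] that m by (simp add: of_nat_diff)
  have "(\<lambda>c. c + (\<Sum>j=1..k. v (cyc m (int m - int j)))) ` C (cyc m (int m - int k)) =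
      (\<lambda>c. c + (\<Sum>j=1..k. v (m - j))) ` C (m - k)" if "k \<in> {0..m-1}" for k
  proof -
    have "(\<Sum>j=1..k. v (cyc m (int m - int j))) = (\<Sum>j=1..k. v (m - j))"
      by (rule sum.cong) (use that in \<open>auto simp: cyc_m\<close>)
    then show ?thesis using that by (simp add: cyc_m)
  qed
  then have "cyclic_fix m C m =
      (\<Inter>k\<in>{0..m-1}. (\<lambda>c. c + (\<Sum>j=1..k. v (m - j))) ` C (m - k))"
    using F[of m] m by (simp cong: INF_cong_simp)
  with v_sum F show ?thesis by blast
qed

end
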